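(* Assume that $$\lim_{t\to 0}\frac{F((i,j),t)}{t^{2}}=+\infty\qquad\text{for all }(i,j)\in[1,m]_{\mathbb Z}\times[1,n]_{\mathbb Z}.$$ Then there exists $\lambda^{\star}>0$ such that, for each $\lambda\in(0,\lambda^{\star})$, the discrete boundary value problem $$\begin{cases}-\Delta_1\big(p(i-1,j)\Delta_1u(i-1,j)\big)-\Delta_2\big(p(i,j-1)\Delta_2u(i,j-1)\big)=\lambda f((i,j),u(i,j)), & (i,j)\in[1,m]_{\mathbb Z}\times[1,n]_{\mathbb Z},\\ u(0,j)=u(m+1,j)=0, & j\in[1,n]_{\mathbb Z},\\ u(i,0)=u(i,n+1)=0, & i\in[1,m]_{\mathbb Z},\end{cases}$$ has at least one nontrivial solution.
   Context: Let $m,n\ge 1$ be integers. For integers $a\le b$ write $[a,b]_{\mathbb Z}=\{a,a+1,\dots,b\}$. The forward difference operators are $\Delta_1u(i,j)=u(i+1,j)-u(i,j)$ and $\Delta_2u(i,j)=u(i,j+1)-u(i,j)$; thus $\Delta_1(p(i-1,j)\Delta_1u(i-1,j))=p(i,j)(u(i+1,j)-u(i,j))-p(i-1,j)(u(i,j)-u(i-1,j))$ and $\Delta_2(p(i,j-1)\Delta_2u(i,j-1))=p(i,j)(u(i,j+1)-u(i,j))-p(i,j-1)(u(i,j)-u(i,j-1))$. Standing assumptions: the weight $p:[0,m]_{\mathbb Z}\times[0,n]_{\mathbb Z}\to[0,+\infty)$ is a given function with $p(0,j)=0$ for all $j\in[1,n]_{\mathbb Z}$, $p(i,0)=0$ for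 all $i\in[1,m]_{\mathbb Z}$, and $p(i,j)>0$ for all $(i,j)\in[1,m]_{\mathbb Z}\times[1,n]_{\mathbb Z}$ (the value $p(0,0)$ does not enter the problem). The function $f:[1,m]_{\mathbb Z}\times[1,n]_{\mathbb Z}\times\mathbb R\to\mathbb R$ is continuous, i.e. $f((i,j),\cdot)$ is continuous for each $(i,j)$, and $F((i,j),x)=\int_0^xf((i,j),t)\,dt$. The number $\lambda$ is a positive real parameter. A solution is a real-valued function $u$ of the grid points (interior points $[1,m]_{\mathbb Z}\times[1,n]_{\mathbb Z}$ together with the boundary points listed in the problem) satisfying all the equations and boundary conditions; it is nontrivial if $u(i,j)\ne0$ for some $(i,j)\in[1,m]_{\mathbb Z}\times[1,n]_{\mathbb Z}$. *)

theory Defs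
  imports "HOL-Analysis.Analysis"
begin

text \<open>Grid functions are total functions on \<open>int \<times> int\<close>; only their values at the points
  occurring in the problem matter.\<close>

definition Delta1 :: "(int \<times> int \<Rightarrow> real) \<Rightarrow> int \<times> int \<Rightarrow> real" where
  "Delta1 u = (\<lambda>(i, j). u (i + 1, j) - u (i, j))"

definition Delta2 :: "(int \<times> int \<Rightarrow> real) \<Rightarrow> int \<times> int \<Rightarrow> real" where
  "Delta2 u = (\<lambda>(i, j). u (i, j + 1) - u (i, j))"

definition admissible_weight :: "int \<Rightarrow> int \<Rightarrow> (int \<times> int \<Rightarrow> real) \<Rightarrow> bool" where
  "admissible_weight m n p \<longleftrightarrow>
     (\<forall>i\<in>{0..m}. \<forall>j\<in>{0..n}. 0 \<le> p (i, j)) \<and>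
     (\<forall>j\<in>{1..n}. p (0, j) = 0) \<and>
     (\<forall>i\<in>{1..m}. p (i, 0) = 0) \<and>
     (\<forall>i\<in>{1..m}. \<forall>j\<in>{1..n}. 0 < p (i, j))"

text \<open>The oriented integral, so that \<open>primitive f z x = - (\<integral> t from x to 0. f z t)\<close> for negative \<open>x\<close>.\<close>

definition primitive :: "(int \<times> int \<Rightarrow> real \<Rightarrow> real) \<Rightarrow> int \<times> int \<Rightarrow> real \<Rightarrow> real" where
  "primitive f z x = (LBINT t=ereal 0..ereal x. f z t)"

text \<open>The corner values \<open>u (0, 0)\<close>, \<open>u (m + 1, 0)\<close>, \<open>u (0, n + 1)\<close>, \<open>u (m + 1, n + 1)\<close> occur
  neither in the equations nor in the boundary conditions.\<close>

definition is_solution ::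
  "int \<Rightarrow> int \<Rightarrow> (int \<times> int \<Rightarrow> real) \<Rightarrow> (int \<times> int \<Rightarrow> real \<Rightarrow> real) \<Rightarrow> real
     \<Rightarrow> (int \<times> int \<Rightarrow> real) \<Rightarrow> bool" where
  "is_solution m n p f lam u \<longleftrightarrow>
     (\<forall>i\<in>{1..m}. \<forall>j\<in>{1..n}.
        - Delta1 (\<lambda>(i, j). p (i - 1, j) * Delta1 u (i - 1, j)) (i, j)
        - Delta2 (\<lambda>(i, j). p (i, j - 1) * Delta2 u (i, j - 1)) (i, j)
        = lam * f (i, j) (u (i, j))) \<and>
     (\<forall>j\<in>{1..n}. u (0, j) = 0 \<and> u (m + 1, j) = 0) \<and>
     (\<forall>i\<in>{1..m}. u (i, 0) = 0 \<and> u (i, n + 1) = 0)"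

definition nontrivial :: "int \<Rightarrow> int \<Rightarrow> (int \<times> int \<Rightarrow> real) \<Rightarrow> bool" where
  "nontrivial m n u \<longleftrightarrow> (\<exists>i\<in>{1..m}. \<exists>j\<in>{1..n}. u (i, j) \<noteq> 0)"

end

theory Submission
  imports Defs
begin

text \<open>The problem is the Euler--Lagrange equation of \<open>J u = energy u - \<lambda> * potential u\<close> on the
  finite-dimensional space of grid functions vanishing outside the interior grid: the energy is
  half the \<open>p\<close>-weighted sum of the squared differences, the potential is the sum of the
  primitives of \<open>f\<close> (\<open>stationary_imp_solution\<close>).

  Minimise \<open>J\<close> over the compact cube of functions with values in \<open>[-1, 1]\<close>. The energy is
  positive definite (\<open>energy_eq_0_imp\<close>), so on the part of the cube where some \<open>\<bar>u z\<bar> = 1\<close> it is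
  bounded below by some \<open>\<delta> > 0\<close>, whereas the potential is bounded above on the cube, say by
  \<open>M\<close>. For \<open>\<lambda> * M < \<delta>\<close> this makes \<open>J\<close> positive there. On the other hand the growth
  hypothesis at \<open>0\<close> makes the potential dominate the quadratic energy on small multiples of a
  unit vector, whatever \<open>\<lambda> > 0\<close> is, so that the minimum of \<open>J\<close> is negative
  (\<open>functional_takes_negative_value\<close>). Hence a minimiser has all its values strictly inside
  \<open>(-1, 1)\<close>, is a critical point and so a solution, and differs from \<open>0\<close> since \<open>J 0 = 0\<close>.\<close>

section \<open>Energy, potential and the unit cube\<close>

definition interior_grid :: "int \<Rightarrow> int \<Rightarrow> (int \<times> int) set" where
  "interior_grid m n = {1..m} \<times> {1..n}"

text \<open>The summands with \<open>i = 0\<close> or \<open>j = 0\<close>, which a discrete Dirichlet energy would contain as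
  well, carry the weight \<open>0\<close>; so the sum runs over interior points only.\<close>

definition energy :: "int \<Rightarrow> int \<Rightarrow> (int \<times> int \<Rightarrow> real) \<Rightarrow> (int \<times> int \<Rightarrow> real) \<Rightarrow> real" where
  "energy m n p u = (\<Sum>w\<in>interior_grid m n. p w * ((Delta1 u w)\<^sup>2 + (Delta2 u w)\<^sup>2) / 2)"

definition potential ::
  "int \<Rightarrow> int \<Rightarrow> (int \<times> int \<Rightarrow> real \<Rightarrow> real) \<Rightarrow> (int \<times> int \<Rightarrow> real) \<Rightarrow> real" where
  "potential m n f u = (\<Sum>w\<in>interior_grid m n. primitive f w (u w))"

definition unit_cube :: "int \<Rightarrow> int \<Rightarrow> (int \<times> int \<Rightarrow> real) set" where
  "unit_cube m n = 
    {u. (\<forall>w\<in>interior_grid m n. \<bar>u w\<bar> \<le> 1) \<and> (\<forall>w. w \<notin> interior_grid m n \<longrightarrow> u w = 0)}"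

lemma finite_interior_grid [simp]: "finite (interior_grid m n)"
  by (simp add: interior_grid_def)

lemma unit_cube_vanishes_outside:
  "u \<in> unit_cube m n \<Longrightarrow> w \<notin> interior_grid m n \<Longrightarrow> u w = 0"
  unfolding unit_cube_def by blast

lemma Delta1_apply: "Delta1 u w = u (fst w + 1, snd w) - u w"
  by (cases w) (simp add: Delta1_def)

lemma Delta2_apply: "Delta2 u w = u (fst w, snd w + 1) - u w"
  by (cases w) (simp add: Delta2_def)

lemma primitive_zero [simp]: "primitive f z 0 = 0"
  by (simp add: primitive_def)

lemma DERIV_primitive:
  assumes "continuous_on UNIV (f z)"
  shows "(primitive f z has_real_derivative f z x) (at x)"
proof -
  have "((\<lambda>u. LBINT y=ereal 0..ereal u. f z y) has_vector_derivative f z x)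
          (at x within {-\<bar>x\<bar>-1..\<bar>x\<bar>+1})"
    by (rule interval_integral_FTC2) (use assms in \<open>auto intro: continuous_on_subset\<close>)
  moreover have "at x within {-\<bar>x\<bar>-1..\<bar>x\<bar>+1} = at x"
    by (rule at_within_interior) auto
  ultimately show ?thesis
    by (simp add: primitive_def[abs_def] has_real_derivative_iff_has_vector_derivative)
qed

section \<open>The energy form\<close>

lemma energy_nonneg:
  assumes "admissible_weight m n p"
  shows "0 \<le> energy m n p u"
  unfolding energy_def
  by (rule sum_nonneg) (use assms in \<open>auto simp: interior_grid_def admissible_weight_def\<close>)

text \<open>Zero energy forces the horizontal differences to vanish at all interior points, so each row
  of \<open>u\<close> is constant up to and including the boundary point with abscissa \<open>m + 1\<close>. The
  degenerate weights at abscissa \<open>0\<close> make it necessary to start from that end.\<close>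

lemma energy_eq_0_imp:
  assumes adm: "admissible_weight m n p"
    and bd: "\<And>w. w \<notin> interior_grid m n \<Longrightarrow> u w = 0"
    and E: "energy m n p u = 0"
  shows "u w = 0"
proof -
  have pos: "0 < p w" if "w \<in> interior_grid m n" for w
    using adm that by (auto simp: interior_grid_def admissible_weight_def)
  have "\<forall>w\<in>interior_grid m n. p w * ((Delta1 u w)\<^sup>2 + (Delta2 u w)\<^sup>2) / 2 = 0"
    using E pos unfolding energy_def
    by (subst (asm) sum_nonneg_eq_0_iff) (auto intro!: mult_nonneg_nonneg intro: less_imp_le[OF pos])
  then have D: "Delta1 u w = 0" if "w \<in> interior_grid m n" for w
    using pos[OF that] that by (auto simp: sum_power2_eq_zero_iff)
  have row: "u (i, j) = 0" if "i \<le> m + 1" for i j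
    using that
  proof (induction i rule: int_le_induct)
    case base
    show ?case by (rule bd) (simp add: interior_grid_def)
  next
    case (step i)
    show ?case
    proof (cases "(i - 1, j) \<in> interior_grid m n")
      case True
      then show ?thesis using D[of "(i - 1, j)"] step by (simp add: Delta1_apply)
    qed (rule bd)
  qed
  have "w \<notin> interior_grid m n" if "\<not> fst w \<le> m + 1"
    using that by (cases w) (simp add: interior_grid_def)
  then show ?thesis
    using row[of "fst w" "snd w"] bd[of w] by auto
qed

lemma energy_scale: "energy m n p (\<lambda>w. t * u w) = t\<^sup>2 * energy m n p u"
  unfolding energy_def sum_distrib_left
  by (rule sum.cong)
     (simp_all add: Delta1_apply Delta2_apply power_mult_distrib algebra_simps power2_eq_square)

text \<open>Summation by parts in its simplest case, for the variation in a single coordinate \<open>z\<close>.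
  Only the terms of the energy at \<open>z\<close> and at its left and lower neighbours involve \<open>u z\<close>.
  A neighbour outside the interior grid carries no term of the energy, which agrees with the
  difference operator because \<open>p\<close> vanishes there.\<close>

lemma DERIV_energy_coordinate:
  assumes adm: "admissible_weight m n p" and z: "(i, j) \<in> interior_grid m n"
  shows "((\<lambda>t. energy m n p (u((i, j) := t))) has_real_derivative
           - Delta1 (\<lambda>(i, j). p (i - 1, j) * Delta1 u (i - 1, j)) (i, j)
           - Delta2 (\<lambda>(i, j). p (i, j - 1) * Delta2 u (i, j - 1)) (i, j)) (at (u (i, j)))"
proof -
  define z where "z = (i, j)"
  let ?G = "interior_grid m n"
  define \<eta> where "\<eta> = (\<lambda>w. if w = z then 1 else (0::real))"
  have coord: "((\<lambda>t. (u(z := t)) w) has_real_derivative \<eta> w) (at s)" for w s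
    by (cases "w = z") (auto simp: \<eta>_def)
  have D1: "((\<lambda>t. Delta1 (u(z := t)) w) has_real_derivative Delta1 \<eta> w) (at s)" for w s
    unfolding Delta1_apply by (intro DERIV_diff coord)
  have D2: "((\<lambda>t. Delta2 (u(z := t)) w) has_real_derivative Delta2 \<eta> w) (at s)" for w s
    unfolding Delta2_apply by (intro DERIV_diff coord)
  have term_deriv: "((\<lambda>t. p w * ((Delta1 (u(z := t)) w)\<^sup>2 + (Delta2 (u(z := t)) w)\<^sup>2) / 2)
          has_real_derivative
          p w * (Delta1 u w * Delta1 \<eta> w) + p w * (Delta2 u w * Delta2 \<eta> w)) (at (u z))" for w
    by (rule DERIV_cong, rule DERIV_cdivide, rule DERIV_cmult, rule DERIV_add,
        rule DERIV_power, rule D1, rule DERIV_power, rule D2) (simp add: field_simps)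
  have 1: "((\<lambda>t. energy m n p (u(z := t))) has_real_derivative
      (\<Sum>w\<in>?G. p w * (Delta1 u w * Delta1 \<eta> w) + p w * (Delta2 u w * Delta2 \<eta> w))) (at (u z))"
    unfolding energy_def by (rule DERIV_sum) (rule term_deriv)
  have D1_\<eta>: "Delta1 \<eta> w = (if w = (i - 1, j) then 1 else 0) - (if w = z then 1 else 0)" for w
    by (cases w) (auto simp: Delta1_apply \<eta>_def z_def)
  have s1: "(\<Sum>w\<in>?G. p w * (Delta1 u w * Delta1 \<eta> w))
      = p (i - 1, j) * Delta1 u (i - 1, j) - p (i, j) * Delta1 u (i, j)"
  proof -
    have "(\<Sum>w\<in>?G. p w * (Delta1 u w * Delta1 \<eta> w))
        = (\<Sum>w\<in>?G. if w = (i - 1, j) then p w * Delta1 u w else 0)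
          - (\<Sum>w\<in>?G. if w = z then p w * Delta1 u w else 0)"
      unfolding sum_subtractf[symmetric]
      by (rule sum.cong) (auto simp: D1_\<eta> z_def)
    moreover have "p (i - 1, j) = 0" if "(i - 1, j) \<notin> ?G"
    proof -
      have "i - 1 = 0" using that z by (auto simp: interior_grid_def)
      then show ?thesis using adm z by (simp add: admissible_weight_def interior_grid_def)
    qed
    ultimately show ?thesis using z by (auto simp: z_def)
  qed
  have D2_\<eta>: "Delta2 \<eta> w = (if w = (i, j - 1) then 1 else 0) - (if w = z then 1 else 0)" for w
    by (cases w) (auto simp: Delta2_apply \<eta>_def z_def)
  have s2: "(\<Sum>w\<in>?G. p w * (Delta2 u w * Delta2 \<eta> w))
      = p (i, j - 1) * Delta2 u (i, j - 1) - p (i, j) * Delta2 u (i, j)"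
  proof -
    have "(\<Sum>w\<in>?G. p w * (Delta2 u w * Delta2 \<eta> w))
        = (\<Sum>w\<in>?G. if w = (i, j - 1) then p w * Delta2 u w else 0)
          - (\<Sum>w\<in>?G. if w = z then p w * Delta2 u w else 0)"
      unfolding sum_subtractf[symmetric]
      by (rule sum.cong) (auto simp: D2_\<eta> z_def)
    moreover have "p (i, j - 1) = 0" if "(i, j - 1) \<notin> ?G"
    proof -
      have "j - 1 = 0" using that z by (auto simp: interior_grid_def)
      then show ?thesis using adm z by (simp add: admissible_weight_def interior_grid_def)
    qed
    ultimately show ?thesis using z by (auto simp: z_def)
  qed
  have "(\<Sum>w\<in>?G. p w * (Delta1 u w * Delta1 \<eta> w) + p w * (Delta2 u w * Delta2 \<eta> w))
    = - Delta1 (\<lambda>(i, j). p (i - 1, j) * Delta1 u (i - 1, j)) (i, j)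
      - Delta2 (\<lambda>(i, j). p (i, j - 1) * Delta2 u (i, j - 1)) (i, j)"
    unfolding sum.distrib s1 s2
    by (simp add: Delta1_def Delta2_def)
  with 1 show ?thesis by (simp add: z_def)
qed

lemma DERIV_potential_coordinate:
  assumes z: "z \<in> interior_grid m n"
    and cont: "\<And>w. w \<in> interior_grid m n \<Longrightarrow> continuous_on UNIV (f w)"
  shows "((\<lambda>t. potential m n f (u(z := t))) has_real_derivative f z (u z)) (at (u z))"
proof -
  have "((\<lambda>t. primitive f w ((u(z := t)) w)) has_real_derivative
          (if w = z then f w (u w) else 0)) (at (u z))" if "w \<in> interior_grid m n" for w
    using DERIV_primitive[of f z "u z", OF cont[OF z]] by (cases "w = z") auto
  then have "((\<lambda>t. potential m n f (u(z := t))) has_real_derivative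
      (\<Sum>w\<in>interior_grid m n. if w = z then f w (u w) else 0)) (at (u z))"
    unfolding potential_def by (rule DERIV_sum)
  then show ?thesis
    using z by simp
qed

section \<open>Critical points are solutions\<close>

lemma stationary_imp_solution:
  assumes adm: "admissible_weight m n p"
    and cont: "\<And>w. w \<in> interior_grid m n \<Longrightarrow> continuous_on UNIV (f w)"
    and bd: "\<And>w. w \<notin> interior_grid m n \<Longrightarrow> u w = 0"
    and stationary: "\<And>z l. z \<in> interior_grid m n \<Longrightarrow>
      ((\<lambda>t. energy m n p (u(z := t)) - lam * potential m n f (u(z := t)))
        has_real_derivative l) (at (u z)) \<Longrightarrow> l = 0"
  shows "is_solution m n p f lam u"
proof -
  have eq: "- Delta1 (\<lambda>(i, j). p (i - 1, j) * Delta1 u (i - 1, j)) (i, j)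
        - Delta2 (\<lambda>(i, j). p (i, j - 1) * Delta2 u (i, j - 1)) (i, j)
        - lam * f (i, j) (u (i, j)) = 0" if "(i, j) \<in> interior_grid m n" for i j
    by (rule stationary[OF that], rule DERIV_diff[OF DERIV_energy_coordinate[OF adm that]],
        rule DERIV_cmult, rule DERIV_potential_coordinate[OF that cont])
  show ?thesis
    unfolding is_solution_def
  proof (intro conjI ballI)
    fix i j assume "i \<in> {1..m}" "j \<in> {1..n}"
    then show "- Delta1 (\<lambda>(i, j). p (i - 1, j) * Delta1 u (i - 1, j)) (i, j)
        - Delta2 (\<lambda>(i, j). p (i, j - 1) * Delta2 u (i, j - 1)) (i, j)
        = lam * f (i, j) (u (i, j))"
      using eq[of i j] by (simp add: interior_grid_def)
  qed (rule bd, simp add: interior_grid_def)+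
qed

section \<open>Compactness and continuity\<close>

text \<open>Grid functions carry the product topology, so compactness of the cube is Tychonoff's
  theorem, without a detour through a Euclidean space of dimension \<open>m * n\<close>.\<close>

lemma compact_unit_cube: "compact (unit_cube m n)"
proof -
  have "u w \<in> (if w \<in> interior_grid m n then {-1..1} else {0}) \<longleftrightarrow>
      (w \<in> interior_grid m n \<longrightarrow> \<bar>u w\<bar> \<le> 1) \<and> (w \<notin> interior_grid m n \<longrightarrow> u w = 0)"
    for u :: "int \<times> int \<Rightarrow> real" and w
    by (simp add: abs_le_iff) linarith
  then have "unit_cube m n = (\<Pi>\<^sub>E w\<in>UNIV. if w \<in> interior_grid m n then {-1..1} else {0})"
    unfolding unit_cube_def PiE_UNIV_domain Pi_def by blast
  moreover have "compactin (product_topology (\<lambda>_. euclidean) UNIV) \<dots>"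
    unfolding compactin_PiE by simp
  ultimately show ?thesis
    by (simp add: euclidean_product_topology)
qed

lemma continuous_on_energy: "continuous_on S (energy m n p)"
  unfolding energy_def[abs_def] Delta1_apply Delta2_apply
  by (intro continuous_intros continuous_on_subset[OF continuous_on_product_coordinates]
      subset_UNIV) simp

lemma continuous_on_potential:
  assumes "\<And>w. w \<in> interior_grid m n \<Longrightarrow> continuous_on UNIV (f w)"
  shows "continuous_on S (potential m n f)"
  unfolding potential_def[abs_def]
proof (intro continuous_on_sum)
  fix w assume "w \<in> interior_grid m n"
  then have "continuous_on UNIV (primitive f w)"
    by (blast intro: DERIV_isCont DERIV_primitive assms continuous_at_imp_continuous_on)
  then show "continuous_on S (\<lambda>u. primitive f w (u w))"
    by (rule continuous_on_compose2)
       (auto intro: continuous_on_subset[OF continuous_on_product_coordinates])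
qed

lemma energy_bounded_below_on_cube_boundary:
  assumes adm: "admissible_weight m n p"
  obtains \<delta> where "0 < \<delta>"
    "\<And>u z. u \<in> unit_cube m n \<Longrightarrow> z \<in> interior_grid m n \<Longrightarrow> \<bar>u z\<bar> = 1 \<Longrightarrow> \<delta> \<le> energy m n p u"
proof -
  define S where "S = unit_cube m n \<inter> (\<Union>z\<in>interior_grid m n. {u. \<bar>u z\<bar> = 1})"
  have "closed {u :: int \<times> int \<Rightarrow> real. \<bar>u z\<bar> = 1}" for z
    by (intro closed_Collect_eq continuous_intros continuous_on_product_coordinates)
  then have "compact S"
    unfolding S_def by (intro compact_Int_closed compact_unit_cube closed_UN) auto
  show thesis
  proof (cases "S = {}")
    \<comment> \<open>This happens only for an empty grid, and then any positive constant will do.\<close>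
    case True
    then show thesis by (intro that[of 1]) (auto simp: S_def)
  next
    case False
    obtain v where v: "v \<in> S" "\<And>u. u \<in> S \<Longrightarrow> energy m n p v \<le> energy m n p u"
      using continuous_attains_inf[OF \<open>compact S\<close> False continuous_on_energy] by blast
    have "energy m n p v \<noteq> 0"
    proof
      assume "energy m n p v = 0"
      then have "v w = 0" for w
        by (rule energy_eq_0_imp[OF adm, rotated])
           (use v(1) unit_cube_vanishes_outside in \<open>auto simp: S_def\<close>)
      with v(1) show False by (auto simp: S_def)
    qed
    with energy_nonneg[OF adm, of v] show thesis
      by (intro that[of "energy m n p v"]) (auto intro!: v(2) simp: S_def)
  qed
qed

lemma potential_bounded_above_on_cube:
  assumes "\<And>w. w \<in> interior_grid m n \<Longrightarrow> continuous_on UNIV (f w)"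
  obtains M where "0 \<le> M" "\<And>u. u \<in> unit_cube m n \<Longrightarrow> potential m n f u \<le> M"
proof -
  have zero: "(\<lambda>_. 0) \<in> unit_cube m n" by (simp add: unit_cube_def)
  then obtain v where v: "\<And>u. u \<in> unit_cube m n \<Longrightarrow> potential m n f u \<le> potential m n f v"
    using continuous_attains_sup[OF compact_unit_cube _ continuous_on_potential[of m n f, OF assms]]
    by blast
  show thesis
    by (rule that[OF _ v]) (use v[OF zero] in \<open>simp_all add: potential_def\<close>)
qed

section \<open>Small functions with negative functional value\<close>

text \<open>On the multiples \<open>t * e\<close> of the unit vector at \<open>z\<close> the functional is
  \<open>t\<^sup>2 * (energy e - \<lambda> * F z t / t\<^sup>2)\<close>, whose second factor tends to \<open>- \<infinity>\<close> as
  \<open>t\<close> tends to \<open>0\<close>.\<close>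

lemma functional_takes_negative_value:
  assumes z: "z \<in> interior_grid m n" and lam: "0 < lam"
    and lim: "filterlim (\<lambda>t. primitive f z t / t\<^sup>2) at_top (at 0)"
  obtains v where "v \<in> unit_cube m n" "energy m n p v - lam * potential m n f v < 0"
proof -
  define e where "e = (\<lambda>w. if w = z then 1 else (0::real))"
  have "\<forall>\<^sub>F t in at 0. energy m n p e / lam < primitive f z t / t\<^sup>2"
    using lim by (simp add: filterlim_at_top_dense)
  moreover have "\<forall>\<^sub>F t in at (0::real). t \<in> {-1<..<1} - {0}"
    by (rule eventually_at_in_open) auto
  ultimately have "\<forall>\<^sub>F t in at (0::real). energy m n p e / lam < primitive f z t / t\<^sup>2
      \<and> t \<in> {-1<..<1} - {0}"
    by (rule eventually_conj)
  then obtain t :: real where t: "energy m n p e / lam < primitive f z t / t\<^sup>2"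
      "t \<in> {-1<..<1} - {0}"
    using eventually_happens' at_neq_bot by blast
  let ?v = "\<lambda>w. t * e w"
  have "potential m n f ?v = (\<Sum>w\<in>interior_grid m n. if w = z then primitive f z t else 0)"
    unfolding potential_def by (rule sum.cong) (auto simp: e_def)
  then have "potential m n f ?v = primitive f z t"
    using z by simp
  moreover have "t\<^sup>2 * energy m n p e < lam * primitive f z t"
    using t lam by (simp add: field_simps)
  ultimately have "energy m n p ?v - lam * potential m n f ?v < 0"
    by (simp add: energy_scale)
  moreover have "?v \<in> unit_cube m n"
    using t(2) z by (auto simp: unit_cube_def e_def)
  ultimately show thesis using that by blast
qed

section \<open>Existence of a nontrivial solution for small parameters\<close>

theorem theorem4p1:
  fixes m n :: int
    and p :: "int \<times> int \<Rightarrow> real"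
    and f :: "int \<times> int \<Rightarrow> real \<Rightarrow> real"
  assumes "1 \<le> m" and "1 \<le> n"
    and "admissible_weight m n p"
    and "\<And>i j. i \<in> {1..m} \<Longrightarrow> j \<in> {1..n} \<Longrightarrow> continuous_on UNIV (f (i, j))"
    and "\<And>i j. i \<in> {1..m} \<Longrightarrow> j \<in> {1..n} \<Longrightarrow>
           filterlim (\<lambda>t. primitive f (i, j) t / t\<^sup>2) at_top (at 0)"
  shows "\<exists>lam_star>0. \<forall>lam\<in>{0<..<lam_star}.
           \<exists>u. is_solution m n p f lam u \<and> nontrivial m n u"
proof -
  note adm = assms(3)
  have cont: "continuous_on UNIV (f w)" if "w \<in> interior_grid m n" for w
    using that assms(4) by (cases w) (auto simp: interior_grid_def)
  obtain \<delta> where \<delta>: "0 < \<delta>" "\<And>u z. u \<in> unit_cube m n \<Longrightarrow> z \<in> interior_grid m n \<Longrightarrow>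
      \<bar>u z\<bar> = 1 \<Longrightarrow> \<delta> \<le> energy m n p u"
    using energy_bounded_below_on_cube_boundary[OF adm] by blast
  obtain M where M: "0 \<le> M" "\<And>u. u \<in> unit_cube m n \<Longrightarrow> potential m n f u \<le> M"
    using potential_bounded_above_on_cube[of m n f, OF cont] by blast
  have "\<exists>u. is_solution m n p f lam u \<and> nontrivial m n u"
    if lam: "lam \<in> {0<..<\<delta> / (M + 1)}" for lam
  proof -
    define J where "J = (\<lambda>u. energy m n p u - lam * potential m n f u)"
    have contJ: "continuous_on (unit_cube m n) J"
      unfolding J_def
      by (intro continuous_intros continuous_on_energy continuous_on_potential cont)
    have corner: "(1, 1) \<in> interior_grid m n"
      using assms(1,2) by (simp add: interior_grid_def)
    obtain v where v: "v \<in> unit_cube m n" "J v < 0"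
    proof (rule functional_takes_negative_value[OF corner])
      show "0 < lam" using lam by simp
      show "filterlim (\<lambda>t. primitive f (1, 1) t / t\<^sup>2) at_top (at 0)"
        using assms(1,2) by (intro assms(5)) auto
    qed (simp add: J_def)
    obtain u where u: "u \<in> unit_cube m n" "\<And>v. v \<in> unit_cube m n \<Longrightarrow> J u \<le> J v"
      using continuous_attains_inf[OF compact_unit_cube _ contJ] v(1) by blast
    have neg: "J u < 0" using u(2)[OF v(1)] v(2) by simp
    note bd = unit_cube_vanishes_outside[OF u(1)]
    have inside: "\<bar>u z\<bar> < 1" if z: "z \<in> interior_grid m n" for z
    proof (rule ccontr)
      assume "\<not> \<bar>u z\<bar> < 1"
      moreover have "\<bar>u z\<bar> \<le> 1"
        using u(1) z by (simp add: unit_cube_def)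
      ultimately have "\<delta> \<le> energy m n p u"
        by (intro \<delta>(2)[OF u(1) z]) auto
      moreover have "lam * potential m n f u \<le> lam * M"
        using M(2)[OF u(1)] lam by (intro mult_left_mono) auto
      moreover have "lam * M \<le> lam * (M + 1)" "lam * (M + 1) < \<delta>"
        using lam M(1) by (auto simp: field_simps)
      ultimately show False using neg by (simp add: J_def)
    qed
    have "is_solution m n p f lam u"
    proof (rule stationary_imp_solution[OF adm cont bd])
      fix z l
      assume z: "z \<in> interior_grid m n"
        and der: "((\<lambda>t. energy m n p (u(z := t)) - lam * potential m n f (u(z := t)))
          has_real_derivative l) (at (u z))"
      have "J (u(z := u z)) \<le> J (u(z := t))" if "\<bar>u z - t\<bar> < 1 - \<bar>u z\<bar>" for t
      proof -
        have "\<bar>t\<bar> \<le> 1" using that by linarith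
        then have "u(z := t) \<in> unit_cube m n" using u(1) z by (auto simp: unit_cube_def)
        then show ?thesis using u(2) by simp
      qed
      with der inside[OF z] show "l = 0"
        by (intro DERIV_local_min[of _ l "u z" "1 - \<bar>u z\<bar>"]) (auto simp: J_def)
    qed
    moreover have "nontrivial m n u"
    proof (rule ccontr)
      assume "\<not> nontrivial m n u"
      then have "u w = 0" if "w \<in> interior_grid m n" for w
        using that by (cases w) (simp add: nontrivial_def interior_grid_def)
      with bd have "u w = 0" for w by blast
      then have "u = (\<lambda>_. 0)" by auto
      then have "J u = 0"
        by (simp add: J_def energy_def potential_def Delta1_apply Delta2_apply)
      with neg show False by simp
    qed
    ultimately show ?thesis by blast
  qed
  moreover have "0 < \<delta> / (M + 1)" using \<delta>(1) M(1) by simp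
  ultimately show ?thesis by blast
qed

end
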